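(* Let $n$ and $r$ be positive integers. If $r$ is even, then $$A^{r}_{n} = \sum_{T_{1}, T_{2}, \ldots, T_{r} \subseteq [n-1]} (-1)^{\sum_{i=1}^{r} |T_{i}|} \cdot 2^{\,n-1 - |\bigcup_{i=1}^{r} T_{i}|} \cdot \prod_{i=1}^{r} \alpha_{n}(T_{i}).$$ If $r$ is odd, then $$A^{r}_{n} = \sum_{\substack{T_{1}, T_{2}, \ldots, T_{r} \subseteq [n-1] \\ T_{1} \cup T_{2} \cup \cdots \cup T_{r} = [n-1]}} (-1)^{\,n-1 + \sum_{i=1}^{r} |T_{i}|} \cdot \prod_{i=1}^{r} \alpha_{n}(T_{i}).$$
   Context: Write $[m]=\{1,2,\ldots,m\}$ (so $[0]=\emptyset$). For a permutation $\pi$ in the symmetric group $\mathfrak{S}_n$, its descent set is $\mathrm{Des}(\pi)=\{i\in[n-1] : \pi_i>\pi_{i+1}\}$. For $S\subseteq[n-1]$, $\beta_n(S)=|\{\pi\in\mathfrak{S}_n : \mathrm{Des}(\pi)=S\}|$, and $\alpha_n(S)=\sum_{T\subseteq S}\beta_n(T)$. Define $A^r_n=\sum_{S\subseteq[n-1]}\beta_n(S)^r$. The sums in the claim run over ordered $r$-tuples of subsets of $[n-1]$. *)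

theory Defs
  imports "HOL-Combinatorics.Permutations" "HOL-Library.FuncSet"
begin

definition descent_set :: "nat \<Rightarrow> (nat \<Rightarrow> nat) \<Rightarrow> nat set" where
  "descent_set n \<pi> = {i \<in> {1..n - 1}. \<pi> i > \<pi> (i + 1)}"

definition beta :: "nat \<Rightarrow> nat set \<Rightarrow> nat" where
  "beta n S = card {\<pi>. \<pi> permutes {1..n} \<and> descent_set n \<pi> = S}"

definition alpha :: "nat \<Rightarrow> nat set \<Rightarrow> nat" where
  "alpha n S = (\<Sum>T\<in>Pow S. beta n T)"

definition beta_power_sum :: "nat \<Rightarrow> nat \<Rightarrow> nat" where
  "beta_power_sum r n = (\<Sum>S\<in>Pow {1..n - 1}. beta n S ^ r)"

text \<open>Ordered \<open>r\<close>-tuples \<open>(T 1, \<dots>, T r)\<close> of subsets of \<open>{1..n - 1}\<close>. The extensional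
  function space makes each tuple occur exactly once.\<close>

definition subset_tuples :: "nat \<Rightarrow> nat \<Rightarrow> (nat \<Rightarrow> nat set) set" where
  "subset_tuples r n = {1..r} \<rightarrow>\<^sub>E Pow {1..n - 1}"

end

theory Submission
  imports Defs
begin

text \<open>By Moebius inversion, \<open>(-1)^|S| \<beta>(S)\<close> is the signed sum of \<open>\<alpha>(T)\<close> over \<open>T \<subseteq> S\<close>. Raise this
  to the power \<open>r\<close>, expand over tuples, sum over \<open>S\<close> and exchange the sums: a tuple with union \<open>U\<close>
  receives the weight \<open>\<Sum> ((-1)^r)^|S|\<close> over \<open>U \<subseteq> S \<subseteq> [n-1]\<close>, which is \<open>c^|U| (1 + c)^(n-1-|U|)\<close>
  with \<open>c = (-1)^r\<close>.\<close>

text \<open>Each such \<open>S\<close> is \<open>U \<union> W\<close> for a unique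
  \<open>W \<subseteq> M - U\<close>, so \<open>c ^ card U\<close> factors out and the generating
  function of the subsets of \<open>M - U\<close> by size remains.\<close>

lemma sum_power_card_between:
  fixes c :: "'b::comm_ring_1"
  assumes "finite M" "U \<subseteq> M"
  shows "(\<Sum>S | U \<subseteq> S \<and> S \<subseteq> M. c ^ card S) = c ^ card U * (1 + c) ^ (card M - card U)"
proof -
  have fin: "finite (M - U)" "finite U"
    using assms finite_subset by auto
  have "(\<Sum>S | U \<subseteq> S \<and> S \<subseteq> M. c ^ card S) = (\<Sum>W\<in>Pow (M - U). c ^ card (U \<union> W))"
    by (rule sum.reindex_bij_witness[where i = "\<lambda>W. U \<union> W" and j = "\<lambda>S. S - U"])
       (use assms in \<open>auto simp: Un_absorb1 intro: arg_cong[where f = "\<lambda>X. c ^ card X"]\<close>)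
  also have "\<dots> = (\<Sum>W\<in>Pow (M - U). c ^ card U * c ^ card W)"
  proof (rule sum.cong)
    fix W assume W: "W \<in> Pow (M - U)"
    then have "card (U \<union> W) = card U + card W"
      using fin by (intro card_Un_disjoint) (auto intro: finite_subset)
    then show "c ^ card (U \<union> W) = c ^ card U * c ^ card W"
      by (simp add: power_add)
  qed simp
  \<comment> \<open>When the product is expanded, \<open>W\<close> records the factors that
    contribute \<open>c\<close>; the others contribute 1.\<close>
  also have "\<dots> = c ^ card U * (\<Prod>_\<in>M - U. c + 1)"
    using fin prod_add[of "M - U" "\<lambda>_. c" "\<lambda>_. 1"] by (simp add: sum_distrib_left)
  also have "\<dots> = c ^ card U * (1 + c) ^ (card M - card U)"
    using assms fin by (simp add: card_Diff_subset add.commute)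
  finally show ?thesis .
qed

text \<open>Symmetric inclusion-exclusion pairs \<open>alpha n\<close> with the signed
  \<open>beta n\<close>: in its premise the two equal signs cancel, which leaves the definition of
  \<open>alpha\<close>.\<close>

lemma beta_eq_sum_alpha:
  assumes "finite S"
  shows "(- 1) ^ card S * int (beta n S) = (\<Sum>T\<in>Pow S. (- 1) ^ card T * int (alpha n T))"
  by (rule inclusion_exclusion_symmetric)
     (simp_all add: alpha_def assms flip: mult.assoc power_add)

lemma beta_power_eq_sum_tuples:
  assumes "finite S"
  shows "int (beta n S ^ r) = ((- 1) ^ r) ^ card S *
    (\<Sum>T\<in>{1..r} \<rightarrow>\<^sub>E Pow S. (- 1) ^ (\<Sum>i=1..r. card (T i)) * (\<Prod>i=1..r. int (alpha n (T i))))"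
proof -
  have "int (beta n S) = (- 1) ^ card S * (\<Sum>T\<in>Pow S. (- 1) ^ card T * int (alpha n T))"
    using assms by (simp flip: beta_eq_sum_alpha mult.assoc power_add)
  \<comment> \<open>The exponents \<open>r\<close> and \<open>card S\<close> are interchanged so
    that the sign becomes a power of a base independent of \<open>S\<close>.\<close>
  then have "int (beta n S ^ r) =
      ((- 1) ^ r) ^ card S * (\<Prod>i=1..r. \<Sum>T\<in>Pow S. (- 1) ^ card T * int (alpha n T))"
    by (simp add: power_mult_distrib mult.commute flip: power_mult)
  \<comment> \<open>Distributivity: choosing one summand from each of the \<open>r\<close> factors
    is choosing a tuple of subsets of \<open>S\<close>.\<close>
  also have "(\<Prod>i=1..r. \<Sum>T\<in>Pow S. (- 1) ^ card T * int (alpha n T)) =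
      (\<Sum>T\<in>{1..r} \<rightarrow>\<^sub>E Pow S. \<Prod>i=1..r. (- 1) ^ card (T i) * int (alpha n (T i)))"
    using assms by (intro prod_sum_PiE) auto
  finally show ?thesis
    by (simp only: prod.distrib power_sum)
qed

text \<open>This treats both parities at once; only the value of \<open>c\<close>, 1 or -1, tells
  them apart.\<close>

lemma beta_power_sum_eq_sum_tuples:
  fixes n r :: nat
  defines "c \<equiv> (- 1) ^ r :: int"
  defines "U \<equiv> \<lambda>T :: nat \<Rightarrow> nat set. \<Union>i\<in>{1..r}. T i"
  shows "int (beta_power_sum r n) = (\<Sum>T\<in>subset_tuples r n.
    (- 1) ^ (\<Sum>i=1..r. card (T i)) * (\<Prod>i=1..r. int (alpha n (T i))) *
    (c ^ card (U T) * (1 + c) ^ (n - 1 - card (U T))))"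
proof -
  let ?M = "{1..n - 1}"
  define w where "w T = (- 1) ^ (\<Sum>i=1..r. card (T i)) * (\<Prod>i=1..r. int (alpha n (T i)))" for T
  have "int (beta_power_sum r n) = (\<Sum>S\<in>Pow ?M. c ^ card S * (\<Sum>T\<in>{1..r} \<rightarrow>\<^sub>E Pow S. w T))"
    unfolding beta_power_sum_def of_nat_sum c_def w_def
    by (intro sum.cong beta_power_eq_sum_tuples) (auto intro: finite_subset[OF _ finite_atLeastAtMost])
  \<comment> \<open>A tuple has all its entries inside \<open>S\<close> exactly when its union is.
    Ranging over tuples in \<open>?M\<close> with this condition makes the index set independent of
    \<open>S\<close>, ready for the exchange of sums.\<close>
  also have "\<dots> = (\<Sum>S\<in>Pow ?M. \<Sum>T | T \<in> subset_tuples r n \<and> U T \<subseteq> S. c ^ card S * w T)"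
  proof (rule sum.cong)
    fix S assume "S \<in> Pow ?M"
    then have "{1..r} \<rightarrow>\<^sub>E Pow S = {T \<in> subset_tuples r n. U T \<subseteq> S}"
      unfolding subset_tuples_def U_def
      by (intro set_eqI) (simp only: PiE_iff UN_subset_iff Pow_iff mem_Collect_eq, blast)
    then show "c ^ card S * (\<Sum>T\<in>{1..r} \<rightarrow>\<^sub>E Pow S. w T) =
        (\<Sum>T | T \<in> subset_tuples r n \<and> U T \<subseteq> S. c ^ card S * w T)"
      by (simp add: sum_distrib_left)
  qed simp
  also have "\<dots> = (\<Sum>T\<in>subset_tuples r n. \<Sum>S | S \<in> Pow ?M \<and> U T \<subseteq> S. c ^ card S * w T)"
    by (rule sum.swap_restrict) (auto simp: subset_tuples_def intro: finite_PiE)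
  also have "\<dots> = (\<Sum>T\<in>subset_tuples r n. w T * (\<Sum>S | U T \<subseteq> S \<and> S \<subseteq> ?M. c ^ card S))"
    by (intro sum.cong) (auto simp: sum_distrib_left mult.commute intro!: sum.cong)
  also have "\<dots> = (\<Sum>T\<in>subset_tuples r n. w T * (c ^ card (U T) * (1 + c) ^ (n - 1 - card (U T))))"
  proof (rule sum.cong)
    fix T assume "T \<in> subset_tuples r n"
    then have "U T \<subseteq> ?M"
      unfolding subset_tuples_def U_def by fastforce
    then show "w T * (\<Sum>S | U T \<subseteq> S \<and> S \<subseteq> ?M. c ^ card S) =
        w T * (c ^ card (U T) * (1 + c) ^ (n - 1 - card (U T)))"
      by (simp add: sum_power_card_between)
  qed simp
  finally show ?thesis
    by (simp add: w_def)
qed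

theorem lemma3p1:
  fixes n r :: nat
  assumes "n \<ge> 1" and "r \<ge> 1"
  shows "(even r \<longrightarrow>
      int (beta_power_sum r n) =
        (\<Sum>T\<in>subset_tuples r n.
           (- 1) ^ (\<Sum>i=1..r. card (T i)) * 2 ^ (n - 1 - card (\<Union>i\<in>{1..r}. T i)) *
           (\<Prod>i=1..r. int (alpha n (T i))))) \<and>
    (odd r \<longrightarrow>
      int (beta_power_sum r n) =
        (\<Sum>T\<in>{T \<in> subset_tuples r n. (\<Union>i\<in>{1..r}. T i) = {1..n - 1}}.
           (- 1) ^ (n - 1 + (\<Sum>i=1..r. card (T i))) *
           (\<Prod>i=1..r. int (alpha n (T i)))))"
proof (intro conjI impI)
  assume "even r"
  \<comment> \<open>Here \<open>c = 1\<close>, so \<open>1 + c\<close> is the 2 of the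
    claim.\<close>
  then show "int (beta_power_sum r n) =
        (\<Sum>T\<in>subset_tuples r n.
           (- 1) ^ (\<Sum>i=1..r. card (T i)) * 2 ^ (n - 1 - card (\<Union>i\<in>{1..r}. T i)) *
           (\<Prod>i=1..r. int (alpha n (T i))))"
    by (simp add: beta_power_sum_eq_sum_tuples mult_ac)
next
  assume odd: "odd r"
  let ?M = "{1..n - 1}" and ?U = "\<lambda>T :: nat \<Rightarrow> nat set. \<Union>i\<in>{1..r}. T i"
  let ?w = "\<lambda>T. (- 1) ^ (\<Sum>i=1..r. card (T i)) * (\<Prod>i=1..r. int (alpha n (T i)))"
  have fin: "finite (subset_tuples r n)"
    by (auto simp: subset_tuples_def intro: finite_PiE)
  \<comment> \<open>Here \<open>c = -1\<close>, so \<open>1 + c = 0\<close>. Since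
    \<open>0 ^ 0 = 1\<close>, the power of 0 is the indicator that the union of the tuple is all of
    \<open>?M\<close>.\<close>
  have "int (beta_power_sum r n) = (\<Sum>T\<in>subset_tuples r n.
      ?w T * ((- 1) ^ card (?U T) * 0 ^ (n - 1 - card (?U T))))"
    using odd by (simp add: beta_power_sum_eq_sum_tuples)
  also have "\<dots> = (\<Sum>T\<in>subset_tuples r n. if ?U T = ?M then (- 1) ^ (n - 1) * ?w T else 0)"
  proof (rule sum.cong)
    fix T assume "T \<in> subset_tuples r n"
    then have sub: "?U T \<subseteq> ?M"
      unfolding subset_tuples_def by fastforce
    show "?w T * ((- 1) ^ card (?U T) * 0 ^ (n - 1 - card (?U T))) =
        (if ?U T = ?M then (- 1) ^ (n - 1) * ?w T else 0)"
    proof (cases "?U T = ?M")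
      case True
      then show ?thesis
        by (simp only: True) simp
    next
      case False
      with sub have "card (?U T) < card ?M"
        by (intro psubset_card_mono) auto
      then have "n - 1 - card (?U T) \<noteq> 0"
        by simp
      with False show ?thesis
        by (simp only: power_0_left if_False mult_zero_right)
    qed
  qed simp
  also have "\<dots> = (\<Sum>T\<in>{T \<in> subset_tuples r n. ?U T = ?M}. (- 1) ^ (n - 1) * ?w T)"
    using fin by (rule sum.inter_filter[symmetric])
  finally show "int (beta_power_sum r n) =
        (\<Sum>T\<in>{T \<in> subset_tuples r n. ?U T = ?M}.
           (- 1) ^ (n - 1 + (\<Sum>i=1..r. card (T i))) *
           (\<Prod>i=1..r. int (alpha n (T i))))"
    by (simp add: power_add mult.assoc)
qed

end
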